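(* Let $m\ge2$, let $q$ be a prime power, and let $d=q^m$, $k=q^{m-1}$, $\lambda=(q^{m-1}-1)/(q-1)$. Let $\mathcal A$ be an affine $(d,k,\lambda)$-BIBD on $\{1,\dots,d\}$ and let $\mathcal B_1,\dots,\mathcal B_r$ be $r=d+1$ mutually unbiased bases of $\mathbb C^d$. For $\beta\in\mathcal A$ and $j\in\{1,\dots,r\}$ let $P^{(j)}_\beta$ be the $\beta$-coordinate projection with respect to $\mathcal B_j$. Then $\mathcal P=\{(1/k)P^{(j)}_\beta: j\in\{1,\dots,d+1\},\ \beta\in\mathcal A\}$ is an optimal arrangement of $n=\frac{(d-1)d(d+1)}{d-k}$ quantum states on $\mathbb C^d$ with purity $\gamma=q^{1-m}$: each element has purity $\gamma$, and among all families of $n$ quantum states on $\mathbb C^d$ with purity at most $\gamma$, $\mathcal P$ maximizes the minimal pairwise chordal distance.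
   Context: A $(v,k,\lambda)$-BIBD is a collection of $k$-element subsets (blocks) of $\{1,\dots,v\}$ such that every pair of distinct points lies in exactly $\lambda$ blocks; it is affine if the blocks can be partitioned into parallel classes (each a partition of $\{1,\dots,v\}$) and there is $\mu\in\mathbb N$ with $|\beta\cap\beta'|=\mu$ for blocks in different classes. Orthonormal bases $\{\eta^{(j,i)}\}_{i=1}^d$, $j=1,\dots,r$, of $\mathbb C^d$ are mutually unbiased if $|\langle\eta^{(j,i)},\eta^{(j',i')}\rangle|^2=1/d$ whenever $j\ne j'$. Given an orthonormal basis $\{b_i\}_{i=1}^d$ and $\beta\subset\{1,\dots,d\}$, the $\beta$-coordinate projection is the orthogonal projection onto $\mathrm{span}\{b_i:i\in\beta\}$. A quantum state on $\mathbb C^d$ is a positive semidefinite Hermitian $d\times d$ matrix of trace $1$, its purity is $\mathrm{tr}(W^2)$, and the chordal distance is $d_c(W,W')=(\mathrm{tr}((W-W')^2))^{1/2}/\sqrt2$. *)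

theory Defs
  imports "HOL-Analysis.Analysis" "HOL-Number_Theory.Prime_Powers"
begin

definition bibd :: "nat \<Rightarrow> nat \<Rightarrow> nat \<Rightarrow> nat set set \<Rightarrow> bool" where
  "bibd v k l \<A> \<longleftrightarrow>
     (\<forall>\<beta>\<in>\<A>. \<beta> \<subseteq> {1..v} \<and> card \<beta> = k) \<and>
     (\<forall>x\<in>{1..v}. \<forall>y\<in>{1..v}. x \<noteq> y \<longrightarrow> card {\<beta>\<in>\<A>. x \<in> \<beta> \<and> y \<in> \<beta>} = l)"

text \<open>\<open>\<C>\<close> is the set of parallel classes.\<close>

definition affine_bibd :: "nat \<Rightarrow> nat \<Rightarrow> nat \<Rightarrow> nat set set \<Rightarrow> bool" where
  "affine_bibd v k l \<A> \<longleftrightarrow> bibd v k l \<A> \<and>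
     (\<exists>\<C> \<mu>. partition_on \<A> \<C> \<and>
        (\<forall>C\<in>\<C>. partition_on {1..v} C) \<and>
        (\<forall>C\<in>\<C>. \<forall>C'\<in>\<C>. C \<noteq> C' \<longrightarrow> (\<forall>\<beta>\<in>C. \<forall>\<beta>'\<in>C'. card (\<beta> \<inter> \<beta>') = \<mu>)))"

text \<open>The space of dimension \<open>d\<close> over the complex numbers is \<open>complex ^ 'n\<close> with \<open>CARD('n) = d\<close>.
  The overloaded \<open>inner\<close> on this type is only the real part of the Hermitian product below.\<close>

definition cinner :: "complex ^ 'n \<Rightarrow> complex ^ 'n \<Rightarrow> complex" where
  "cinner x y = (\<Sum>i\<in>UNIV. cnj (x $ i) * y $ i)"

definition orthonormal_basis :: "(nat \<Rightarrow> complex ^ 'n) \<Rightarrow> bool" where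
  "orthonormal_basis b \<longleftrightarrow>
     (\<forall>i\<in>{1..CARD('n)}. \<forall>i'\<in>{1..CARD('n)}. cinner (b i) (b i') = (if i = i' then 1 else 0)) \<and>
     vec.span (b ` {1..CARD('n)}) = UNIV"

definition mutually_unbiased_bases :: "nat \<Rightarrow> (nat \<Rightarrow> nat \<Rightarrow> complex ^ 'n) \<Rightarrow> bool" where
  "mutually_unbiased_bases r \<eta> \<longleftrightarrow>
     (\<forall>j\<in>{1..r}. orthonormal_basis (\<eta> j)) \<and>
     (\<forall>j\<in>{1..r}. \<forall>j'\<in>{1..r}. j \<noteq> j' \<longrightarrow>
        (\<forall>i\<in>{1..CARD('n)}. \<forall>i'\<in>{1..CARD('n)}.
           (cmod (cinner (\<eta> j i) (\<eta> j' i')))\<^sup>2 = 1 / real CARD('n)))"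

text \<open>Meaningful for a complex subspace \<open>S\<close>, where the matrix exists and is unique.\<close>

definition orthogonal_projection :: "(complex ^ 'n) set \<Rightarrow> complex ^ 'n ^ 'n" where
  "orthogonal_projection S =
     (THE P. \<forall>x. P *v x \<in> S \<and> (\<forall>y\<in>S. cinner y (x - P *v x) = 0))"

definition coordinate_projection :: "(nat \<Rightarrow> complex ^ 'n) \<Rightarrow> nat set \<Rightarrow> complex ^ 'n ^ 'n" where
  "coordinate_projection b \<beta> = orthogonal_projection (vec.span (b ` \<beta>))"

definition hermitian :: "complex ^ 'n ^ 'n \<Rightarrow> bool" where
  "hermitian W \<longleftrightarrow> (\<forall>i j. W $ i $ j = cnj (W $ j $ i))"

definition positive_semidefinite :: "complex ^ 'n ^ 'n \<Rightarrow> bool" where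
  "positive_semidefinite W \<longleftrightarrow> hermitian W \<and> (\<forall>x. 0 \<le> Re (cinner x (W *v x)))"

definition quantum_state :: "complex ^ 'n ^ 'n \<Rightarrow> bool" where
  "quantum_state W \<longleftrightarrow> positive_semidefinite W \<and> trace W = 1"

text \<open>For Hermitian arguments the traces below are real, so that \<open>Re\<close> is a mere coercion.\<close>

definition purity :: "complex ^ 'n ^ 'n \<Rightarrow> real" where
  "purity W = Re (trace (W ** W))"

definition chordal_distance :: "complex ^ 'n ^ 'n \<Rightarrow> complex ^ 'n ^ 'n \<Rightarrow> real" where
  "chordal_distance W W' = sqrt (Re (trace ((W - W') ** (W - W')))) / sqrt 2"

text \<open>Arrangements are families \<open>W\<close> over a finite index set \<open>I\<close>, so a competing family may repeat
  a state, in which case its minimal distance is \<open>0\<close>. The minimum is meaningful only if \<open>I\<close> has at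
  least two elements. A set \<open>S\<close> of states is the family \<open>\<lambda>W. W\<close> over \<open>S\<close>.\<close>

definition min_chordal_distance :: "'i set \<Rightarrow> ('i \<Rightarrow> complex ^ 'n ^ 'n) \<Rightarrow> real" where
  "min_chordal_distance I W =
     Min {chordal_distance (W i) (W j) | i j. i \<in> I \<and> j \<in> I \<and> i \<noteq> j}"

definition state_arrangement ::
    "nat \<Rightarrow> real \<Rightarrow> 'i set \<Rightarrow> ('i \<Rightarrow> complex ^ 'n ^ 'n) \<Rightarrow> bool" where
  "state_arrangement n \<gamma> I W \<longleftrightarrow>
     finite I \<and> card I = n \<and> (\<forall>i\<in>I. quantum_state (W i) \<and> purity (W i) \<le> \<gamma>)"

definition optimal_state_arrangement ::
    "nat \<Rightarrow> real \<Rightarrow> 'i set \<Rightarrow> ('i \<Rightarrow> complex ^ 'n ^ 'n) \<Rightarrow> bool" where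
  "optimal_state_arrangement n \<gamma> I W \<longleftrightarrow>
     state_arrangement n \<gamma> I W \<and>
     (\<forall>V :: nat \<Rightarrow> complex ^ 'n ^ 'n. state_arrangement n \<gamma> {1..n} V \<longrightarrow>
        min_chordal_distance {1..n} V \<le> min_chordal_distance I W)"

end

theory Submission
  imports Defs
begin

text \<open>Subtracting \<open>I / d\<close> moves states of purity at most \<open>\<gamma>\<close> into the ball of squared radius
  \<open>\<gamma> - 1 / d\<close> of the real space of traceless Hermitian matrices, which has dimension \<open>d\<^sup>2 - 1\<close>.
  More than \<open>d\<^sup>2\<close> vectors there cannot have pairwise negative inner products, so two of the states
  are at chordal distance at most \<open>sqrt (\<gamma> - 1 / d)\<close> (Rankin's bound). The inner product of two
  elements of \<open>\<P>\<close> is \<open>1 / d\<close> for different bases, by unbiasedness, and for the same basis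
  and blocks of different parallel classes, which meet in \<open>k\<^sup>2 / d\<close> points; it is \<open>0\<close> for
  disjoint blocks. Hence \<open>\<P>\<close> attains the bound.\<close>

section \<open>Obtuse families of vectors\<close>

text \<open>Set one vector \<open>z\<close> aside. If the others still outnumber the dimension, they
  satisfy a nontrivial linear relation. Moving its negative coefficients to the other side writes
  one vector \<open>p\<close> as a nonnegative combination of two disjoint subfamilies. Obtuseness
  forces \<open>p = 0\<close>, and pairing with \<open>z\<close> then forces both subfamilies to be
  empty.\<close>

lemma card_le_Suc_dim_of_obtuse:
  fixes S :: "'a::euclidean_space set"
  assumes fin: "finite S"
    and neg: "\<And>x y. x \<in> S \<Longrightarrow> y \<in> S \<Longrightarrow> x \<noteq> y \<Longrightarrow> x \<bullet> y < 0"
  shows "card S \<le> Suc (dim S)"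
proof (rule ccontr)
  assume "\<not> card S \<le> Suc (dim S)"
  then have big: "Suc (dim S) < card S" by simp
  then have "S \<noteq> {}" by auto
  then obtain z where z: "z \<in> S" by blast
  define T where "T = S - {z}"
  have finT: "finite T" using fin by (simp add: T_def)
  have "card T = card S - 1" using z fin by (simp add: T_def)
  moreover have "dim T \<le> dim S" by (rule dim_subset) (auto simp: T_def)
  ultimately have "dim T < card T" using big by linarith
  then have "dependent T" using finT
    by (metis dim_eq_card_independent less_irrefl)
  then obtain u v0 where v0: "v0 \<in> T" "u v0 \<noteq> 0" and u: "(\<Sum>v\<in>T. u v *\<^sub>R v) = 0"
    using real_vector.dependent_finite[OF finT] by blast
  define Pos where "Pos = {v\<in>T. u v > 0}"
  define Neg where "Neg = {v\<in>T. u v < 0}"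
  have finPN: "finite Pos" "finite Neg" using finT by (auto simp: Pos_def Neg_def)
  define p where "p = (\<Sum>v\<in>Pos. u v *\<^sub>R v)"
  have "(\<Sum>v\<in>T. u v *\<^sub>R v) = (\<Sum>v\<in>Pos \<union> Neg. u v *\<^sub>R v)"
    by (rule sum.mono_neutral_right[OF finT]) (auto simp: Pos_def Neg_def)
  also have "\<dots> = p + (\<Sum>v\<in>Neg. u v *\<^sub>R v)"
    unfolding p_def by (rule sum.union_disjoint[OF finPN]) (auto simp: Pos_def Neg_def)
  finally have p_neg: "p = (\<Sum>v\<in>Neg. (- u v) *\<^sub>R v)"
    using u by (simp add: sum_negf eq_neg_iff_add_eq_0)
  \<comment> \<open>One factor is expanded over \<open>Pos\<close> and the other over
    \<open>Neg\<close>. The two sets are disjoint, so only inner products of distinct vectors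
    occur.\<close>
  have "p \<bullet> p = (\<Sum>v\<in>Pos. u v *\<^sub>R v) \<bullet> (\<Sum>w\<in>Neg. (- u w) *\<^sub>R w)"
    by (simp only: p_neg[symmetric] p_def[symmetric])
  also have "\<dots> = (\<Sum>v\<in>Pos. \<Sum>w\<in>Neg. u v * (- u w) * (v \<bullet> w))"
    by (subst inner_sum_left) (simp add: inner_sum_right sum_distrib_left mult_ac)
  also have "\<dots> \<le> 0"
  proof (intro sum_nonpos mult_nonneg_nonpos)
    fix v w assume "v \<in> Pos" "w \<in> Neg"
    then show "0 \<le> u v * - u w" "v \<bullet> w \<le> 0"
      by (auto simp: Pos_def Neg_def T_def mult_nonneg_nonpos intro!: less_imp_le[OF neg])
  qed
  finally have p0: "p = 0" by (metis inner_ge_zero inner_eq_zero_iff order_antisym)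
  have "v \<bullet> z < 0" if "v \<in> T" for v using that z by (auto simp: T_def intro!: neg)
  \<comment> \<open>A vanishing combination with positive coefficients has inner product 0 with
    \<open>z\<close>, yet every term contributes a negative amount; so there are no terms.\<close>
  then have empty: "X = {}"
    if "finite X" "X \<subseteq> T" "\<And>v. v \<in> X \<Longrightarrow> 0 < c v" "(\<Sum>v\<in>X. c v *\<^sub>R v) = 0" for X c
  proof (rule_tac ccontr)
    assume "X \<noteq> {}"
    have "(\<Sum>v\<in>X. c v * (v \<bullet> z)) < (\<Sum>v\<in>X. 0)"
      using that \<open>X \<noteq> {}\<close> \<open>\<And>v. v \<in> T \<Longrightarrow> v \<bullet> z < 0\<close>
      by (intro sum_strict_mono) (auto intro!: mult_pos_neg)
    moreover have "(\<Sum>v\<in>X. c v *\<^sub>R v) \<bullet> z = (\<Sum>v\<in>X. c v * (v \<bullet> z))"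
      by (simp add: inner_sum_left)
    ultimately show False using that(4) by simp
  qed
  have "Pos = {}" by (rule empty[of _ u]) (use finPN p0 in \<open>auto simp: Pos_def p_def\<close>)
  moreover have "Neg = {}"
    by (rule empty[of _ "\<lambda>v. - u v"]) (use finPN p0 p_neg in \<open>auto simp: Neg_def\<close>)
  moreover have "0 < u v0 \<or> u v0 < 0" using v0 by linarith
  ultimately show False using v0(1) unfolding Pos_def Neg_def by blast
qed

section \<open>Hermitian matrices\<close>

lemma hermitianI: "(\<And>i j. cnj (A $ i $ j) = A $ j $ i) \<Longrightarrow> hermitian A"
  by (metis hermitian_def)

lemma hermitian_cnj: "hermitian A \<Longrightarrow> cnj (A $ i $ j) = A $ j $ i"
  by (metis hermitian_def)

text \<open>The Euclidean inner product of matrices sums the real parts of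
  \<open>cnj (A $ i $ j) * B $ i $ j\<close>, and Hermitian symmetry turns the conjugate into the
  transposed entry. Purity and chordal distance thereby become a squared norm and a scaled Euclidean
  distance.\<close>

lemma inner_eq_Re_trace:
  fixes A B :: "complex ^ 'n ^ 'n"
  assumes "hermitian A"
  shows "A \<bullet> B = Re (trace (A ** B))"
proof -
  have "A \<bullet> B = (\<Sum>i\<in>UNIV. \<Sum>j\<in>UNIV. Re (cnj (A $ i $ j) * B $ i $ j))"
    by (simp add: inner_vec_def inner_complex_def)
  also have "\<dots> = (\<Sum>i\<in>UNIV. \<Sum>j\<in>UNIV. Re (A $ j $ i * B $ i $ j))"
    by (simp only: hermitian_cnj[OF assms])
  also have "\<dots> = Re (trace (A ** B))"
    by (subst sum.swap) (simp add: trace_def matrix_matrix_mult_def)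
  finally show ?thesis .
qed

lemma hermitian_diff: "hermitian A \<Longrightarrow> hermitian B \<Longrightarrow> hermitian (A - B)"
  by (rule hermitianI) (simp add: hermitian_cnj)

lemma purity_eq_norm: "hermitian W \<Longrightarrow> purity W = (norm W)\<^sup>2"
  by (simp add: purity_def inner_eq_Re_trace[symmetric] power2_norm_eq_inner)

lemma chordal_distance_eq_norm:
  "hermitian W \<Longrightarrow> hermitian W' \<Longrightarrow> chordal_distance W W' = norm (W - W') / sqrt 2"
  by (simp add: chordal_distance_def inner_eq_Re_trace[OF hermitian_diff, symmetric]
      norm_eq_sqrt_inner)

lemma subspace_hermitian: "subspace {A :: complex ^ 'n ^ 'n. hermitian A}"
  by (auto simp: subspace_def hermitian_cnj intro!: hermitianI)

text \<open>\<open>Re\<close> is symmetric and \<open>Im\<close> is antisymmetric on a Hermitian matrix, so that their sum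
  determines both.\<close>

lemma dim_hermitian_le: "dim {A :: complex ^ 'n ^ 'n. hermitian A} \<le> CARD('n) * CARD('n)"
proof -
  define f :: "complex ^ 'n ^ 'n \<Rightarrow> real ^ 'n ^ 'n"
    where "f A = (\<chi> i j. Re (A $ i $ j) + Im (A $ i $ j))" for A
  have lin: "linear f"
    by (rule linearI) (auto simp: f_def vec_eq_iff algebra_simps)
  have "inj_on f {A. hermitian A}"
  proof (rule inj_onI; clarsimp)
    fix A B :: "complex ^ 'n ^ 'n" assume A: "hermitian A" and B: "hermitian B" and eq: "f A = f B"
    have "A $ i $ j = B $ i $ j" for i j
    proof -
      have "Re (A $ i $ j) + Im (A $ i $ j) = Re (B $ i $ j) + Im (B $ i $ j)" for i j
        using eq by (auto simp: f_def vec_eq_iff)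
      from this[of i j] this[of j i]
      have "Re (A $ i $ j) + Im (A $ i $ j) = Re (B $ i $ j) + Im (B $ i $ j)"
        "Re (A $ j $ i) + Im (A $ j $ i) = Re (B $ j $ i) + Im (B $ j $ i)" by auto
      moreover have "cnj (A $ i $ j) = A $ j $ i" "cnj (B $ i $ j) = B $ j $ i"
        using A B by (auto simp: hermitian_cnj)
      ultimately show ?thesis unfolding complex_eq_iff by auto
    qed
    then show "A = B" by (simp add: vec_eq_iff)
  qed
  then have "dim {A :: complex ^ 'n ^ 'n. hermitian A} = dim (f ` {A. hermitian A})"
    by (intro dim_image_eq[symmetric] lin) (simp add: span_eq_iff[THEN iffD2, OF subspace_hermitian])
  also have "\<dots> \<le> DIM(real ^ 'n ^ 'n)" by (rule dim_subset_UNIV)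
  finally show ?thesis by simp
qed

lemma trace_mat_complex: "trace (mat c :: complex ^ 'n ^ 'n) = of_nat CARD('n) * c"
  by (simp add: trace_def mat_def)

lemma hermitian_mat_of_real: "hermitian (mat (of_real c) :: complex ^ 'n ^ 'n)"
  by (rule hermitianI) (simp add: mat_def)

text \<open>The identity matrix is Hermitian with nonzero trace, so the traceless matrices form a
  proper subspace. The strict inequality absorbs the \<open>Suc\<close> of the bound for obtuse
  families.\<close>

lemma dim_traceless_hermitian_less:
  "dim {A :: complex ^ 'n ^ 'n. hermitian A \<and> trace A = 0} < CARD('n) * CARD('n)"
proof -
  let ?T = "{A :: complex ^ 'n ^ 'n. hermitian A \<and> trace A = 0}"
  let ?H = "{A :: complex ^ 'n ^ 'n. hermitian A}"
  have sT: "subspace ?T"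
    using subspace_hermitian[where 'n='n]
    by (auto simp: subspace_def trace_def sum.distrib scaleR_sum_right[symmetric])
  have "(mat 1 :: complex ^ 'n ^ 'n) \<in> ?H - ?T"
    using hermitian_mat_of_real[of 1] trace_mat_complex[where 'n='n, of 1] by simp
  then have "?T \<subset> ?H" by blast
  then have "span ?T \<subset> span ?H"
    by (simp only: span_eq_iff[THEN iffD2, OF sT] span_eq_iff[THEN iffD2, OF subspace_hermitian])
  then have "dim ?T < dim ?H" by (rule dim_psubset)
  with dim_hermitian_le[where 'n='n] show ?thesis by linarith
qed

section \<open>Rankin's bound for states of bounded purity\<close>

lemma close_pair_exists:
  fixes V :: "'i \<Rightarrow> complex ^ 'n ^ 'n"
  assumes fin: "finite I" and card: "CARD('n) * CARD('n) < card I"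
    and herm: "\<And>i. i \<in> I \<Longrightarrow> hermitian (V i)" and tr: "\<And>i. i \<in> I \<Longrightarrow> trace (V i) = 1"
    and pur: "\<And>i. i \<in> I \<Longrightarrow> purity (V i) \<le> \<gamma>"
  shows "\<exists>i\<in>I. \<exists>j\<in>I. i \<noteq> j \<and> chordal_distance (V i) (V j) \<le> sqrt (\<gamma> - 1 / CARD('n))"
proof -
  \<comment> \<open>The maximally mixed state is the centre of the ball. Its inner product with any
    state is the reciprocal of the dimension, hence the radius found in
    \<open>U_norm\<close>.\<close>
  define e :: "complex ^ 'n ^ 'n" where "e = mat (of_real (1 / CARD('n)))"
  define U where "U i = V i - e" for i
  have herm_e: "hermitian e" unfolding e_def by (rule hermitian_mat_of_real)
  have tr_e: "trace e = 1" by (simp add: e_def trace_mat_complex)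
  have e_inner: "e \<bullet> A = Re (trace A) / CARD('n)" for A
  proof -
    have "e ** A = (\<chi> i j. A $ i $ j / CARD('n))"
      by (simp add: e_def matrix_matrix_mult_def mat_def vec_eq_iff if_distrib[of "\<lambda>x. x * _"] cong: if_cong)
    then have "trace (e ** A) = trace A / CARD('n)"
      by (simp add: trace_def sum_divide_distrib)
    then show ?thesis by (simp add: inner_eq_Re_trace[OF herm_e])
  qed
  have U_norm: "(norm (U i))\<^sup>2 \<le> \<gamma> - 1 / CARD('n)" if "i \<in> I" for i
  proof -
    have "(norm (U i))\<^sup>2 = (norm (V i))\<^sup>2 - 2 * (e \<bullet> V i) + e \<bullet> e"
      by (simp add: U_def power2_norm_eq_inner inner_diff_left inner_diff_right inner_commute)
    also have "\<dots> = purity (V i) - 1 / CARD('n)"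
      by (simp add: e_inner tr that tr_e purity_eq_norm[OF herm[OF that]])
    finally show ?thesis using pur[OF that] by simp
  qed
  have "\<exists>i\<in>I. \<exists>j\<in>I. i \<noteq> j \<and> 0 \<le> U i \<bullet> U j"
  proof (rule ccontr)
    assume "\<not> ?thesis"
    then have neg: "U i \<bullet> U j < 0" if "i \<in> I" "j \<in> I" "i \<noteq> j" for i j
      using that by (meson linorder_not_less)
    have inj: "inj_on U I"
      by (rule inj_onI) (metis neg inner_ge_zero linorder_not_less)
    have "card (U ` I) \<le> Suc (dim (U ` I))"
      by (rule card_le_Suc_dim_of_obtuse) (use fin neg in auto)
    also have "dim (U ` I) \<le> dim {A :: complex ^ 'n ^ 'n. hermitian A \<and> trace A = 0}"
      by (rule dim_subset) (auto simp: U_def herm herm_e hermitian_diff tr tr_e trace_sub)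
    also have "Suc (dim {A :: complex ^ 'n ^ 'n. hermitian A \<and> trace A = 0}) \<le> CARD('n) * CARD('n)"
      using dim_traceless_hermitian_less by (rule Suc_leI)
    finally show False using card by (simp add: card_image[OF inj])
  qed
  then obtain i j where ij: "i \<in> I" "j \<in> I" "i \<noteq> j" "0 \<le> U i \<bullet> U j" by blast
  \<comment> \<open>The centre cancels in differences. The inner product has the right sign to be
    dropped, and the factor 2 that remains cancels against the \<open>sqrt 2\<close> in the chordal
    distance.\<close>
  have "(norm (V i - V j))\<^sup>2 = (norm (U i))\<^sup>2 + (norm (U j))\<^sup>2 - 2 * (U i \<bullet> U j)"
    by (simp add: U_def power2_norm_eq_inner inner_diff_left inner_diff_right inner_commute)
  then have "(norm (V i - V j))\<^sup>2 \<le> 2 * (\<gamma> - 1 / CARD('n))"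
    using ij U_norm[of i] U_norm[of j] by simp
  then have "norm (V i - V j) \<le> sqrt (2 * (\<gamma> - 1 / CARD('n)))"
    by (rule real_le_rsqrt)
  then have "norm (V i - V j) / sqrt 2 \<le> sqrt (\<gamma> - 1 / CARD('n))"
    unfolding real_sqrt_mult by (simp add: pos_divide_le_eq mult.commute)
  then show ?thesis using ij herm by (auto simp: chordal_distance_eq_norm)
qed

section \<open>Coordinate projections\<close>

text \<open>The sum of the rank-one matrices that belong to the vectors \<open>b i\<close>: an
  explicit candidate for the coordinate projection, which is itself given only by a definite
  description.\<close>

definition outer_sum :: "(nat \<Rightarrow> complex ^ 'n) \<Rightarrow> nat set \<Rightarrow> complex ^ 'n ^ 'n" where
  "outer_sum b \<beta> = (\<chi> r s. \<Sum>i\<in>\<beta>. b i $ r * cnj (b i $ s))"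

lemma cinner_diff_right: "cinner x (y - z) = cinner x y - cinner x z"
  by (simp add: cinner_def right_diff_distrib sum_subtractf)

lemma cinner_add_left: "cinner (x + y) z = cinner x z + cinner y z"
  by (simp add: cinner_def distrib_right sum.distrib)

lemma cinner_scale_left: "cinner (c *s x) z = cnj c * cinner x z"
  by (simp add: cinner_def sum_distrib_left mult_ac)

lemma cinner_sum_right: "cinner x (\<Sum>i\<in>\<beta>. f i) = (\<Sum>i\<in>\<beta>. cinner x (f i))"
  by (simp add: cinner_def sum_distrib_left) (rule sum.swap)

lemma cinner_scale_right: "cinner x (c *s z) = c * cinner x z"
  by (simp add: cinner_def sum_distrib_left mult_ac)

lemma cinner_commute: "cinner x y = cnj (cinner y x)"
  by (simp add: cinner_def mult.commute)

lemma cinner_self: "cinner x x = of_real ((norm x)\<^sup>2)"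
  by (simp add: cinner_def norm_vec_def L2_set_def sum_nonneg
      complex_norm_square[symmetric] mult.commute[of "cnj _"])

lemma cinner_mult_cnj: "cinner y x * cinner x y = of_real ((cmod (cinner x y))\<^sup>2)"
  by (subst cinner_commute) (simp add: complex_norm_square mult.commute del: of_real_power)

lemma outer_sum_mult_vec: "outer_sum b \<beta> *v x = (\<Sum>i\<in>\<beta>. cinner (b i) x *s b i)"
proof -
  have "(outer_sum b \<beta> *v x) $ r = (\<Sum>i\<in>\<beta>. cinner (b i) x *s b i) $ r" for r
    by (simp add: outer_sum_def matrix_vector_mult_def cinner_def sum_distrib_left
        sum_distrib_right mult_ac)
      (rule sum.swap)
  then show ?thesis by (simp add: vec_eq_iff)
qed

text \<open>Orthonormality yields the defining property of the projection on the spanning vectors,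
  and linearity extends it to the span. For uniqueness, the difference of the values of two
  candidates lies in the subspace and is orthogonal to it, hence has norm 0.\<close>

lemma coordinate_projection_eq_outer_sum:
  fixes b :: "nat \<Rightarrow> complex ^ 'n"
  assumes b: "orthonormal_basis b" and \<beta>: "\<beta> \<subseteq> {1..CARD('n)}"
  shows "coordinate_projection b \<beta> = outer_sum b \<beta>"
  unfolding coordinate_projection_def orthogonal_projection_def
proof (rule the_equality)
  let ?S = "vec.span (b ` \<beta>)"
  have fin: "finite \<beta>" using \<beta> by (rule finite_subset) simp
  have on: "cinner (b i) (b i') = (if i = i' then 1 else 0)" if "i \<in> \<beta>" "i' \<in> \<beta>" for i i'
    using that b \<beta> unfolding orthonormal_basis_def by blast
  have in_S: "outer_sum b \<beta> *v x \<in> ?S" for x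
    unfolding outer_sum_mult_vec
    by (intro vec.span_sum vec.span_scale vec.span_base imageI)
  have perp: "cinner y (x - outer_sum b \<beta> *v x) = 0" if "y \<in> ?S" for x y
    using that
  proof (induction rule: vec.span_induct_alt)
    case base
    then show ?case by (simp add: cinner_def)
  next
    case (step c z y)
    then obtain i where i: "i \<in> \<beta>" "z = b i" by blast
    have "cinner (b i) (outer_sum b \<beta> *v x) = (\<Sum>i'\<in>\<beta>. cinner (b i') x * (if i = i' then 1 else 0))"
      by (simp add: outer_sum_mult_vec cinner_sum_right cinner_scale_right on i cong: sum.cong)
    also have "\<dots> = cinner (b i) x"
      by (simp add: if_distrib[of "\<lambda>x. _ * x"] fin i cong: if_cong)
    finally show ?case
      using step i by (simp add: cinner_add_left cinner_scale_left cinner_diff_right)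
  qed
  show "\<forall>x. outer_sum b \<beta> *v x \<in> ?S \<and> (\<forall>y\<in>?S. cinner y (x - outer_sum b \<beta> *v x) = 0)"
    using in_S perp by blast
  fix Q :: "complex ^ 'n ^ 'n"
  assume Q: "\<forall>x. Q *v x \<in> ?S \<and> (\<forall>y\<in>?S. cinner y (x - Q *v x) = 0)"
  have "Q *v x = outer_sum b \<beta> *v x" for x
  proof -
    let ?z = "Q *v x - outer_sum b \<beta> *v x"
    have "?z \<in> ?S" using Q in_S by (simp add: vec.span_diff)
    then have "cinner ?z (x - outer_sum b \<beta> *v x) - cinner ?z (x - Q *v x) = 0"
      using Q perp by simp
    then have "cinner ?z ?z = 0" by (simp add: cinner_diff_right)
    then show ?thesis by (simp add: cinner_self)
  qed
  then show "Q = outer_sum b \<beta>" by (simp add: matrix_eq)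
qed

section \<open>Traces, inner products and positivity of sums of rank-one matrices\<close>

lemma trace_outer_sum: "trace (outer_sum b \<beta>) = (\<Sum>i\<in>\<beta>. cinner (b i) (b i))"
  by (simp add: trace_def outer_sum_def cinner_def mult.commute) (rule sum.swap)

lemma trace_outer_sum_mult_left:
  fixes b :: "nat \<Rightarrow> complex ^ 'n"
  shows "trace (outer_sum b \<beta> ** A) = (\<Sum>i\<in>\<beta>. cinner (b i) (A *v b i))"
proof -
  let ?f = "\<lambda>i r s. b i $ r * (cnj (b i $ s) * A $ s $ r)"
  have "trace (outer_sum b \<beta> ** A) = (\<Sum>r\<in>UNIV. \<Sum>s\<in>UNIV. \<Sum>i\<in>\<beta>. ?f i r s)"
    by (simp add: trace_def matrix_matrix_mult_def outer_sum_def sum_distrib_right mult.assoc)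
  also have "\<dots> = (\<Sum>s\<in>UNIV. \<Sum>r\<in>UNIV. \<Sum>i\<in>\<beta>. ?f i r s)" by (rule sum.swap)
  also have "\<dots> = (\<Sum>s\<in>UNIV. \<Sum>i\<in>\<beta>. \<Sum>r\<in>UNIV. ?f i r s)"
    by (intro sum.cong refl sum.swap)
  also have "\<dots> = (\<Sum>i\<in>\<beta>. \<Sum>s\<in>UNIV. \<Sum>r\<in>UNIV. ?f i r s)" by (rule sum.swap)
  also have "\<dots> = (\<Sum>i\<in>\<beta>. cinner (b i) (A *v b i))"
    by (simp add: cinner_def matrix_vector_mult_def sum_distrib_left mult_ac)
  finally show ?thesis .
qed

lemma trace_outer_sum_mult:
  fixes b c :: "nat \<Rightarrow> complex ^ 'n"
  shows "trace (outer_sum b \<beta> ** outer_sum c \<beta>') =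
    of_real (\<Sum>i\<in>\<beta>. \<Sum>i'\<in>\<beta>'. (cmod (cinner (b i) (c i')))\<^sup>2)"
  by (simp only: trace_outer_sum_mult_left outer_sum_mult_vec cinner_sum_right
      cinner_scale_right cinner_mult_cnj of_real_sum)

lemma hermitian_outer_sum: "hermitian (outer_sum b \<beta>)"
  by (rule hermitianI) (simp add: outer_sum_def mult.commute)

lemma outer_sum_inner:
  "outer_sum b \<beta> \<bullet> outer_sum c \<beta>' = (\<Sum>i\<in>\<beta>. \<Sum>i'\<in>\<beta>'. (cmod (cinner (b i) (c i')))\<^sup>2)"
  by (simp add: inner_eq_Re_trace[OF hermitian_outer_sum] trace_outer_sum_mult)

lemma positive_semidefinite_outer_sum: "positive_semidefinite (outer_sum b \<beta>)"
proof -
  have "cinner x (outer_sum b \<beta> *v x) = of_real (\<Sum>i\<in>\<beta>. (cmod (cinner x (b i)))\<^sup>2)" for x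
    by (simp add: outer_sum_mult_vec cinner_sum_right cinner_scale_right cinner_mult_cnj)
  then show ?thesis
    by (simp add: positive_semidefinite_def hermitian_outer_sum sum_nonneg)
qed

lemma positive_semidefinite_scaleR:
  assumes "positive_semidefinite A" "0 \<le> c"
  shows "positive_semidefinite (c *\<^sub>R A)"
proof -
  have "cinner x ((c *\<^sub>R A) *v x) = c *\<^sub>R cinner x (A *v x)" for x
    by (simp add: cinner_def matrix_vector_mult_def scaleR_sum_right[symmetric])
  moreover have "hermitian (c *\<^sub>R A)"
    using assms(1) by (intro hermitianI) (simp add: positive_semidefinite_def hermitian_cnj)
  ultimately show ?thesis
    using assms by (simp add: positive_semidefinite_def)
qed

lemma outer_sum_inner_orthonormal:
  fixes b :: "nat \<Rightarrow> complex ^ 'n"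
  assumes "orthonormal_basis b" "\<beta> \<subseteq> {1..CARD('n)}" "\<beta>' \<subseteq> {1..CARD('n)}"
  shows "outer_sum b \<beta> \<bullet> outer_sum b \<beta>' = card (\<beta> \<inter> \<beta>')"
proof -
  have fin: "finite \<beta>" "finite \<beta>'" using assms(2,3) finite_subset by auto
  have on: "cinner (b i) (b i') = (if i = i' then 1 else 0)" if "i \<in> \<beta>" "i' \<in> \<beta>'" for i i'
    using that assms unfolding orthonormal_basis_def by blast
  have "outer_sum b \<beta> \<bullet> outer_sum b \<beta>' = (\<Sum>i\<in>\<beta>. \<Sum>i'\<in>\<beta>'. if i = i' then 1 else 0)"
    unfolding outer_sum_inner by (intro sum.cong refl) (simp add: on)
  also have "\<dots> = (\<Sum>i\<in>\<beta>. if i \<in> \<beta>' then 1 else 0)" using fin by simp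
  also have "\<dots> = card (\<beta> \<inter> \<beta>')" using fin by (simp add: sum.If_cases)
  finally show ?thesis .
qed

lemma outer_sum_inner_unbiased:
  fixes \<eta> :: "nat \<Rightarrow> nat \<Rightarrow> complex ^ 'n"
  assumes "mutually_unbiased_bases r \<eta>" "j \<in> {1..r}" "j' \<in> {1..r}" "j \<noteq> j'"
    "\<beta> \<subseteq> {1..CARD('n)}" "\<beta>' \<subseteq> {1..CARD('n)}"
  shows "outer_sum (\<eta> j) \<beta> \<bullet> outer_sum (\<eta> j') \<beta>' = real (card \<beta>) * real (card \<beta>') / CARD('n)"
proof -
  have "(cmod (cinner (\<eta> j i) (\<eta> j' i')))\<^sup>2 = 1 / CARD('n)" if "i \<in> \<beta>" "i' \<in> \<beta>'" for i i'
    using that assms unfolding mutually_unbiased_bases_def by blast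
  then show ?thesis by (simp add: outer_sum_inner)
qed

section \<open>Counting in block designs\<close>

lemma bibd_finite: "bibd v k l \<A> \<Longrightarrow> finite \<A>"
  by (rule finite_subset[of _ "Pow {1..v}"]) (auto simp: bibd_def)

text \<open>Double counting of the pairs of a block through \<open>x\<close> and a second point
  \<open>y\<close> on it.\<close>

lemma bibd_replication:
  assumes "bibd v k l \<A>" "x \<in> {1..v}"
  shows "card {\<beta>\<in>\<A>. x \<in> \<beta>} * (k - 1) = l * (v - 1)"
proof -
  let ?R = "{\<beta>\<in>\<A>. x \<in> \<beta>}"
  let ?Y = "{1..v} - {x}"
  have fin: "finite ?R" using bibd_finite[OF assms(1)] by simp
  have sub: "\<beta> \<subseteq> {1..v}" and ck: "card \<beta> = k" if "\<beta> \<in> \<A>" for \<beta>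
    using that assms(1) by (auto simp: bibd_def)
  have "card ?R * (k - 1) = (\<Sum>\<beta>\<in>?R. card {y\<in>?Y. y \<in> \<beta>})"
  proof -
    have "card {y\<in>?Y. y \<in> \<beta>} = k - 1" if "\<beta> \<in> ?R" for \<beta>
    proof -
      have "{y\<in>?Y. y \<in> \<beta>} = \<beta> - {x}" using sub[of \<beta>] that by blast
      then show ?thesis using that ck finite_subset[OF sub] by simp
    qed
    then show ?thesis by simp
  qed
  also have "\<dots> = (\<Sum>y\<in>?Y. card {\<beta>\<in>?R. y \<in> \<beta>})"
    by (rule sum_multicount_gen[OF fin]) auto
  also have "\<dots> = (\<Sum>y\<in>?Y. l)"
  proof (rule sum.cong[OF refl])
    fix y assume "y \<in> ?Y"
    then have "card {\<beta>\<in>\<A>. x \<in> \<beta> \<and> y \<in> \<beta>} = l"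
      using assms by (simp add: bibd_def)
    then show "card {\<beta>\<in>?R. y \<in> \<beta>} = l" by simp
  qed
  also have "\<dots> = l * (v - 1)" using assms(2) by simp
  finally show ?thesis .
qed

text \<open>Double counting of the incident pairs of a point and a block.\<close>

lemma bibd_incidences:
  assumes "bibd v k l \<A>" "\<And>x. x \<in> {1..v} \<Longrightarrow> card {\<beta>\<in>\<A>. x \<in> \<beta>} = r"
  shows "card \<A> * k = v * r"
proof -
  have "(\<Sum>x\<in>{1..v}. card {\<beta>\<in>\<A>. x \<in> \<beta>}) = (\<Sum>\<beta>\<in>\<A>. k)"
  proof (rule sum_multicount_gen[OF _ bibd_finite[OF assms(1)]])
    have "\<beta> \<subseteq> {1..v}" "card \<beta> = k" if "\<beta> \<in> \<A>" for \<beta>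
      using assms(1) that by (auto simp: bibd_def)
    moreover have "{x\<in>{1..v}. x \<in> \<beta>} = \<beta>" if "\<beta> \<subseteq> {1..v}" for \<beta> using that by blast
    ultimately show "\<forall>\<beta>\<in>\<A>. card {x\<in>{1..v}. x \<in> \<beta>} = k" by metis
  qed simp
  then show ?thesis using assms(2) by simp
qed

text \<open>The classes cut \<open>Y\<close> into disjoint pieces of equal size. This serves for
  \<open>Y\<close> the whole point set, cut into blocks of size \<open>k\<close>, and for
  \<open>Y\<close> a block, cut by a parallel class other than its own.\<close>

lemma partition_on_uniform_card:
  assumes "partition_on X C" "finite X"
    "\<And>\<beta>. \<beta> \<in> C \<Longrightarrow> card (Y \<inter> \<beta>) = c" "Y \<subseteq> X"
  shows "card Y = card C * c"
proof -
  have finC: "finite C" using assms(1,2) finite_elements by blast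
  have "Y = (\<Union>\<beta>\<in>C. Y \<inter> \<beta>)" using assms(1,4) by (auto simp: partition_on_def)
  then have "card Y = card (\<Union>\<beta>\<in>C. Y \<inter> \<beta>)" by simp
  also have "\<dots> = (\<Sum>\<beta>\<in>C. card (Y \<inter> \<beta>))"
  proof (rule card_UN_disjoint[OF finC])
    show "\<forall>\<beta>\<in>C. finite (Y \<inter> \<beta>)" using assms(2,4) finite_subset by blast
    show "\<forall>\<beta>\<in>C. \<forall>\<beta>'\<in>C. \<beta> \<noteq> \<beta>' \<longrightarrow> (Y \<inter> \<beta>) \<inter> (Y \<inter> \<beta>') = {}"
      using partition_onD2[OF assms(1)] by (fastforce simp: disjoint_def)
  qed
  finally show ?thesis using assms(3) by simp
qed

text \<open>Blocks of one class are disjoint. For different classes, let the second consist of s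
  blocks: then v = s k and k = s \<mu>, so \<mu> v = k k. The inequality covers both cases at
  once.\<close>

lemma affine_bibd_inter:
  assumes "affine_bibd v k l \<A>" "\<beta> \<in> \<A>" "\<beta>' \<in> \<A>" "\<beta> \<noteq> \<beta>'"
  shows "card (\<beta> \<inter> \<beta>') * v \<le> k * k"
proof -
  from assms(1) obtain \<C> \<mu> where bibd: "bibd v k l \<A>" and part: "partition_on \<A> \<C>"
    and classes: "\<And>C. C \<in> \<C> \<Longrightarrow> partition_on {1..v} C"
    and \<mu>: "\<And>C C' \<beta> \<beta>'. C \<in> \<C> \<Longrightarrow> C' \<in> \<C> \<Longrightarrow> C \<noteq> C' \<Longrightarrow> \<beta> \<in> C \<Longrightarrow> \<beta>' \<in> C' \<Longrightarrow> card (\<beta> \<inter> \<beta>') = \<mu>"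
    unfolding affine_bibd_def by metis
  have sub: "\<beta> \<subseteq> {1..v}" and ck: "card \<beta> = k" if "\<beta> \<in> \<A>" for \<beta>
    using that bibd by (auto simp: bibd_def)
  from assms(2,3) part obtain C C' where C: "C \<in> \<C>" "\<beta> \<in> C" and C': "C' \<in> \<C>" "\<beta>' \<in> C'"
    by (auto simp: partition_on_def)
  show ?thesis
  proof (cases "C = C'")
    case True
    then have "\<beta> \<inter> \<beta>' = {}"
      using classes[OF C(1)] C C' assms(4) by (auto simp: partition_on_def disjoint_def)
    then show ?thesis by simp
  next
    case False
    have C'A: "C' \<subseteq> \<A>" using part C' by (auto simp: partition_on_def)
    have "card {1..v} = card C' * k"
      by (rule partition_on_uniform_card[OF classes[OF C'(1)]])
        (use C'A sub ck in \<open>auto simp: Int_absorb1 subset_iff\<close>)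
    moreover have "card \<beta> = card C' * \<mu>"
      by (rule partition_on_uniform_card[OF classes[OF C'(1)]])
        (use \<mu> False C C' sub assms(2) in auto)
    ultimately show ?thesis using \<mu>[OF C(1) C'(1) False C(2) C'(2)] ck[OF assms(2)] by simp
  qed
qed

text \<open>Since k - 1 = l (q - 1), cancelling \<open>l\<close> in the replication identity leaves
  r (q - 1) = q k - 1 for the number \<open>r\<close> of blocks through a point. Counting incidences
  then gives the number of blocks.\<close>

lemma bibd_card_blocks:
  assumes "bibd (q ^ m) (q ^ (m - 1)) ((q ^ (m - 1) - 1) div (q - 1)) \<A>" "2 \<le> q" "2 \<le> m"
  shows "card \<A> * (q - 1) = q * (q ^ m - 1)"
proof -
  define k where "k = q ^ (m - 1)"
  define l where "l = (k - 1) div (q - 1)"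
  have qm: "q ^ m = q * k" using assms(3) by (cases m) (auto simp: k_def)
  have "q ^ 1 \<le> k" unfolding k_def using assms by (intro power_increasing) auto
  then have k2: "2 \<le> k" using assms(2) by simp
  have "(q - 1) dvd (k - 1)"
  proof -
    \<comment> \<open>The factorization of a difference of powers shows that the division defining
      \<open>l\<close> is exact. It is applied over the integers, where subtraction is not
      truncated.\<close>
    have "int q - 1 dvd int q ^ (m - 1) - 1 ^ (m - 1)"
      by (metis dvd_triv_left power_diff_sumr2)
    then have "int (q - 1) dvd int (k - 1)"
      using assms(2) k2 by (simp add: k_def)
    then show ?thesis by presburger
  qed
  then have l: "l * (q - 1) = k - 1" by (simp add: l_def)
  then have "0 < l" using k2 by (cases l) auto
  have bibd: "bibd (q * k) k l \<A>" using assms(1) by (simp add: qm k_def l_def)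
  define r where "r = (q * k - 1) div (q - 1)"
  have rep: "card {\<beta>\<in>\<A>. x \<in> \<beta>} * (q - 1) = q * k - 1" if "x \<in> {1..q * k}" for x
  proof -
    have "l * (card {\<beta>\<in>\<A>. x \<in> \<beta>} * (q - 1)) = l * (q * k - 1)"
      using bibd_replication[OF bibd that] unfolding l[symmetric] by (simp only: mult_ac)
    then show ?thesis using \<open>0 < l\<close> by simp
  qed
  have r: "card {\<beta>\<in>\<A>. x \<in> \<beta>} = r" if "x \<in> {1..q * k}" for x
    unfolding r_def rep[OF that, symmetric] using assms(2) by simp
  \<comment> \<open>The equation for \<open>r\<close> is read off at a point, so one has to
    exist.\<close>
  have "1 \<in> {1..q * k}" using assms(2) k2 by (auto simp: Suc_le_eq)
  with rep r have "r * (q - 1) = q * k - 1" by metis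
  moreover have "card \<A> * k = q * k * r" by (rule bibd_incidences[OF bibd r])
  ultimately have "k * (card \<A> * (q - 1)) = k * (q * (q * k - 1))"
    by (simp add: mult_ac) (metis mult.assoc)
  then show ?thesis using k2 by (simp add: qm)
qed

theorem theorem3p11:
  fixes q m d k l n :: nat
    and \<gamma> :: real
    and \<A> :: "nat set set"
    and \<eta> :: "nat \<Rightarrow> nat \<Rightarrow> complex ^ 'n"
    and \<P> :: "(complex ^ 'n ^ 'n) set"
  assumes "m \<ge> 2" and "primepow q"
    and "d = q ^ m" and "k = q ^ (m - 1)" and "l = (q ^ (m - 1) - 1) div (q - 1)"
    and "CARD('n) = d"
    and "n = ((d - 1) * d * (d + 1)) div (d - k)"
    and "\<gamma> = real q powi (1 - int m)"
    and "affine_bibd d k l \<A>"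
    and "mutually_unbiased_bases (d + 1) \<eta>"
    and "\<P> = {(1 / real k) *\<^sub>R coordinate_projection (\<eta> j) \<beta> | j \<beta>. j \<in> {1..d + 1} \<and> \<beta> \<in> \<A>}"
  shows "real n = (real d - 1) * real d * (real d + 1) / (real d - real k) \<and>
         (\<forall>W\<in>\<P>. purity W = \<gamma>) \<and>
         optimal_state_arrangement n \<gamma> \<P> (\<lambda>W. W)"
proof -

  \<comment> \<open>Parameters and the number of states\<close>
  have q2: "2 \<le> q" using primepow_gt_Suc_0[OF assms(2)] by simp
  have dk: "d = q * k" using assms(1,3,4) by (cases m) auto
  have "q ^ 1 \<le> k" unfolding assms(4) using assms(1) q2 by (intro power_increasing) auto
  then have qk: "q \<le> k" by simp
  then have k2: "2 \<le> k" using q2 by simp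
  have kd: "2 * k \<le> d" using q2 by (simp add: dk)
  have \<gamma>: "\<gamma> = 1 / real k"
  proof -
    have "1 - int m = - int (m - 1)" using assms(1) by simp
    then show ?thesis
      by (simp only: assms(8,4) power_int_minus power_int_of_nat of_nat_power inverse_eq_divide)
  qed
  have bibd: "bibd d k l \<A>" using assms(9) by (simp add: affine_bibd_def)
  have finA: "finite \<A>" by (rule bibd_finite[OF bibd])
  have sub: "\<beta> \<subseteq> {1..CARD('n)}" and ck: "card \<beta> = k" if "\<beta> \<in> \<A>" for \<beta>
    using that bibd by (auto simp: bibd_def assms(6))
  have blocks: "card \<A> * (q - 1) = q * (d - 1)"
    using bibd_card_blocks[of q m \<A>] bibd assms(1,3,4,5) q2 by simp

  \<comment> \<open>With d - k = k (q - 1), the block count shows that the division defining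
    \<open>n\<close> is exact and that \<open>n\<close> counts the pairs of a basis and a
    block.\<close>
  have n_mult: "(d - 1) * d * (d + 1) = (d + 1) * card \<A> * (d - k)"
  proof -
    have "d - k = k * (q - 1)" by (simp add: dk diff_mult_distrib2 mult.commute)
    then have "(d + 1) * card \<A> * (d - k) = (d + 1) * k * (card \<A> * (q - 1))"
      by (simp only: mult_ac)
    also have "\<dots> = (d - 1) * (q * k) * (d + 1)" unfolding blocks by (simp only: mult_ac)
    also have "\<dots> = (d - 1) * d * (d + 1)" by (simp only: dk)
    finally show ?thesis by simp
  qed
  have n: "n = (d + 1) * card \<A>" unfolding assms(7) n_mult using kd k2 by simp
  have n_real: "real n = (real d - 1) * real d * (real d + 1) / (real d - real k)"
  proof -
    have "real ((d - 1) * d * (d + 1)) = real (n * (d - k))" by (simp only: n_mult n)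
    then show ?thesis using kd k2 by (simp add: field_simps)
  qed
  \<comment> \<open>Rankin's bound needs more than d d states. From q (d - 1) \<ge> d (q - 1) there
    are at least \<open>d\<close> blocks, and the \<open>d + 1\<close> bases push the product past d
    d.\<close>
  have n_large: "d * d < n"
  proof -
    have "q * (d - 1) = (q - 1) * (d - 1) + (d - 1)" using q2 by (cases q) auto
    moreover have "q - 1 \<le> d - 1" using qk kd by simp
    ultimately have "(q - 1) * (d - 1) + (q - 1) \<le> card \<A> * (q - 1)" using blocks by simp
    moreover have "(q - 1) * (d - 1) + (q - 1) = d * (q - 1)" using kd k2 by (cases d) auto
    ultimately have "d \<le> card \<A>" using q2 by simp
    then have "(d + 1) * d \<le> n" unfolding n by (rule mult_le_mono2)
    then show ?thesis using kd k2 by simp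
  qed

  \<comment> \<open>The scaled projections as vectors: norms and inner products\<close>
  define S where "S = (\<lambda>(j, \<beta>). (1 / real k) *\<^sub>R outer_sum (\<eta> j) \<beta>)"
  define X where "X = {1..d + 1} \<times> \<A>"
  have onb: "orthonormal_basis (\<eta> j)" if "j \<in> {1..d + 1}" for j
    using that assms(10) by (simp add: mutually_unbiased_bases_def)
  have "(1 / real k) *\<^sub>R coordinate_projection (\<eta> j) \<beta> = S (j, \<beta>)"
    if "j \<in> {1..d + 1} \<and> \<beta> \<in> \<A>" for j \<beta>
    using coordinate_projection_eq_outer_sum[OF onb sub] that by (simp add: S_def)
  then have "\<P> = {S (j, \<beta>) | j \<beta>. j \<in> {1..d + 1} \<and> \<beta> \<in> \<A>}"
    unfolding assms(11) by (intro Collect_cong ex_cong1) metis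
  then have P: "\<P> = S ` X" unfolding X_def by blast
  have herm: "hermitian (S x)" for x
    by (cases x) (auto simp: S_def hermitian_cnj[OF hermitian_outer_sum] intro!: hermitianI)
  have self: "S x \<bullet> S x = 1 / real k" if "x \<in> X" for x
  proof -
    obtain j \<beta> where x: "x = (j, \<beta>)" "j \<in> {1..d + 1}" "\<beta> \<in> \<A>" using \<open>x \<in> X\<close> by (auto simp: X_def)
    have "outer_sum (\<eta> j) \<beta> \<bullet> outer_sum (\<eta> j) \<beta> = real k"
      using outer_sum_inner_orthonormal[OF onb[OF x(2)] sub[OF x(3)] sub[OF x(3)]] ck[OF x(3)] by simp
    then show ?thesis using k2 by (simp add: x(1) S_def)
  qed
  \<comment> \<open>Only an upper bound is needed, since smaller inner products mean larger
    distances; disjoint blocks of one basis, with value 0, need no separate treatment.\<close>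
  have inner_le: "S x \<bullet> S y \<le> 1 / real d" if xy: "x \<in> X" "y \<in> X" "x \<noteq> y" for x y
  proof -
    obtain j \<beta> j' \<beta>' where [simp]: "x = (j, \<beta>)" "y = (j', \<beta>')" by (metis surj_pair)
    have mem: "j \<in> {1..d + 1}" "\<beta> \<in> \<A>" "j' \<in> {1..d + 1}" "\<beta>' \<in> \<A>" using xy by (auto simp: X_def)
    have "outer_sum (\<eta> j) \<beta> \<bullet> outer_sum (\<eta> j') \<beta>' \<le> real k * real k / real d"
    proof (cases "j = j'")
      case True
      then have "card (\<beta> \<inter> \<beta>') * d \<le> k * k"
        using affine_bibd_inter[OF assms(9) mem(2,4)] xy by simp
      then have "real (card (\<beta> \<inter> \<beta>')) * real d \<le> real k * real k"
        by (metis of_nat_le_iff of_nat_mult)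
      then show ?thesis
        using outer_sum_inner_orthonormal[OF onb[OF mem(1)] sub[OF mem(2)] sub[OF mem(4)]] True kd k2
        by (simp add: pos_le_divide_eq)
    next
      case False
      then show ?thesis
        using outer_sum_inner_unbiased[OF assms(10) mem(1,3) False sub[OF mem(2)] sub[OF mem(4)]]
        by (simp add: ck mem assms(6))
    qed
    then show ?thesis using k2 by (simp add: S_def field_simps)
  qed
  \<comment> \<open>Coinciding states would have inner product 1 / k, above the bound for distinct
    indices. So the set \<open>\<P>\<close> has as many elements as there are index pairs.\<close>
  have "1 / real d < 1 / real k" using kd k2 by (simp add: frac_less2)
  then have inj: "inj_on S X" using self inner_le
    by (intro inj_onI) (metis less_le_not_le)
  have card_P: "card \<P> = n"
    unfolding P card_image[OF inj] unfolding X_def n card_cartesian_product by simp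
  have fin_P: "finite \<P>" using finA by (simp add: P X_def)
  have purity: "purity W = \<gamma>" if "W \<in> \<P>" for W
    using that self by (auto simp: P purity_eq_norm[OF herm] power2_norm_eq_inner \<gamma>)
  have state: "quantum_state W" if "W \<in> \<P>" for W
  proof -
    obtain j \<beta> where "(j, \<beta>) \<in> X" and W_S: "W = S (j, \<beta>)"
      using \<open>W \<in> \<P>\<close> unfolding P by (metis imageE surj_pair)
    then have "j \<in> {1..d + 1}" "\<beta> \<in> \<A>" by (simp_all add: X_def)
    have W: "W = (1 / real k) *\<^sub>R outer_sum (\<eta> j) \<beta>" by (simp add: W_S S_def)
    have "cinner (\<eta> j i) (\<eta> j i) = 1" if "i \<in> \<beta>" for i
      using onb[OF \<open>j \<in> _\<close>] sub[OF \<open>\<beta> \<in> \<A>\<close>] that unfolding orthonormal_basis_def by auto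
    then have "trace (outer_sum (\<eta> j) \<beta>) = of_nat k"
      by (simp add: trace_outer_sum ck[OF \<open>\<beta> \<in> \<A>\<close>])
    moreover have "trace W = (1 / real k) *\<^sub>R trace (outer_sum (\<eta> j) \<beta>)"
      by (simp add: W trace_def scaleR_sum_right)
    ultimately have "trace W = 1" using k2 by (simp add: scaleR_conv_of_real)
    then show ?thesis
      by (auto simp: quantum_state_def W intro!: positive_semidefinite_scaleR positive_semidefinite_outer_sum)
  qed
  \<comment> \<open>All elements have squared norm \<gamma>, so a squared distance is 2 (\<gamma> -
    s) with s the inner product, and s is at most 1 / d.\<close>
  have far: "sqrt (\<gamma> - 1 / real d) \<le> chordal_distance W W'" if "W \<in> \<P>" "W' \<in> \<P>" "W \<noteq> W'" for W W'
  proof -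
    obtain x where x: "W = S x" "x \<in> X" using \<open>W \<in> \<P>\<close> unfolding P by (rule imageE)
    obtain y where y: "W' = S y" "y \<in> X" using \<open>W' \<in> \<P>\<close> unfolding P by (rule imageE)
    have neq: "x \<noteq> y" using x y that(3) by blast
    have "(norm (W - W'))\<^sup>2 = S x \<bullet> S x + S y \<bullet> S y - 2 * (S x \<bullet> S y)"
      by (simp add: x(1) y(1) power2_norm_eq_inner inner_diff_left inner_diff_right inner_commute)
    also have "\<dots> = 2 * (\<gamma> - S x \<bullet> S y)"
      by (simp only: self[OF x(2)] self[OF y(2)] \<gamma>) simp
    also have "\<dots> \<ge> 2 * (\<gamma> - 1 / real d)"
      by (intro mult_left_mono diff_left_mono inner_le[OF x(2) y(2) neq]) simp
    finally have "sqrt (2 * (\<gamma> - 1 / real d)) \<le> norm (W - W')" by (rule real_le_lsqrt[rotated]) simp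
    then show ?thesis unfolding real_sqrt_mult
      by (simp add: x(1) y(1) chordal_distance_eq_norm herm pos_le_divide_eq mult.commute)
  qed

  \<comment> \<open>Comparison with an arbitrary competing family\<close>
  have "min_chordal_distance {1..n} V \<le> min_chordal_distance \<P> (\<lambda>W. W)"
    if V: "state_arrangement n \<gamma> {1..n} V" for V :: "nat \<Rightarrow> complex ^ 'n ^ 'n"
  proof -
    \<comment> \<open>\<open>Min\<close> is governed by its usual rules only on finite sets. The
      index type is left general because the fact is applied both to natural numbers and to the
      states themselves.\<close>
    have fin_dist: "finite {chordal_distance (f i) (f j) | i j. i \<in> I \<and> j \<in> I \<and> i \<noteq> j}"
      if "finite I" for I :: "'i set" and f :: "'i \<Rightarrow> complex ^ 'n ^ 'n"
      by (rule finite_subset[of _ "(\<lambda>(i, j). chordal_distance (f i) (f j)) ` (I \<times> I)"])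
        (use that in auto)
    have st: "hermitian (V i)" "trace (V i) = 1" "purity (V i) \<le> \<gamma>" if "i \<in> {1..n}" for i
      using V that
      by (auto simp: state_arrangement_def quantum_state_def positive_semidefinite_def)
    have "\<exists>i\<in>{1..n}. \<exists>j\<in>{1..n}. i \<noteq> j \<and> chordal_distance (V i) (V j) \<le> sqrt (\<gamma> - 1 / CARD('n))"
      by (rule close_pair_exists) (use st n_large assms(6) in auto)
    then obtain i j where "i \<in> {1..n}" "j \<in> {1..n}" "i \<noteq> j"
      and close: "chordal_distance (V i) (V j) \<le> sqrt (\<gamma> - 1 / real d)" using assms(6) by auto
    then have "min_chordal_distance {1..n} V \<le> chordal_distance (V i) (V j)"
      unfolding min_chordal_distance_def by (intro Min_le fin_dist) blast+
    also note close
    also have "sqrt (\<gamma> - 1 / real d) \<le> min_chordal_distance \<P> (\<lambda>W. W)"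
      unfolding min_chordal_distance_def
    proof (rule Min.boundedI[OF fin_dist[OF fin_P]])
      \<comment> \<open>A lower bound on \<open>Min\<close> also requires a nonempty set of
        distances, that is, two distinct states in \<open>\<P>\<close>.\<close>
      have "2 \<le> d * d" using kd k2 by (cases d) auto
      then have "1 < card \<P>" using card_P n_large by simp
      then obtain W W' where "W \<in> \<P>" "W' \<in> \<P>" "W \<noteq> W'"
        by (metis One_nat_def card_le_Suc0_iff_eq fin_P linorder_not_le)
      then show "{chordal_distance W W' | W W'. W \<in> \<P> \<and> W' \<in> \<P> \<and> W \<noteq> W'} \<noteq> {}" by blast
    qed (use far in auto)
    finally show ?thesis .
  qed
  then have "optimal_state_arrangement n \<gamma> \<P> (\<lambda>W. W)"
    using fin_P card_P state purity
    by (simp add: optimal_state_arrangement_def state_arrangement_def)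
  with n_real purity show ?thesis by blast
qed

end
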